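(* Let $G$ be any group. Then Ruzsa distance $\mathrm{d}$ is a metric on the set of finite index subgroups of $G$.
   Context: The basic measure on a group $G$: the measurable sets are $\emptyset$ and all finite unions of left and right cosets of finite index subgroups of $G$. Each measurable $A$ is a union of some number $r$ of cosets of a finite index normal subgroup $R$ of $G$, and $|A|=r/[G:R]$ (well defined, finitely additive, $|G|=1$). Products $AB=\{ab:a\in A,b\in B\}$ and inverses $A^{-1}=\{a^{-1}:a\in A\}$ of measurable sets are measurable. For non-empty measurable sets $A,B$ the (left) Ruzsa distance is $\mathrm{d}(A,B)=\log\frac{|AB^{-1}|}{|A|^{1/2}|B|^{1/2}}$. *)

theory Defs
  imports "HOL-Algebra.Coset" "HOL-Analysis.Abstract_Metric_Spaces"
begin

definition finite_index_subgroups :: "('a, 'b) monoid_scheme \<Rightarrow> 'a set set"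
  where "finite_index_subgroups G = {H. subgroup H G \<and> finite (rcosets\<^bsub>G\<^esub> H)}"

(* The empty set is the union of the empty family. *)
definition basic_measurable_sets :: "('a, 'b) monoid_scheme \<Rightarrow> 'a set set"
  where "basic_measurable_sets G =
    {\<Union>F |F. finite F \<and>
       (\<forall>C\<in>F. \<exists>H\<in>finite_index_subgroups G. \<exists>x\<in>carrier G.
          C = x <#\<^bsub>G\<^esub> H \<or> C = H #>\<^bsub>G\<^esub> x)}"

(* The value r / [G:R] does not depend on the choice of the finite index normal
   subgroup R for which A is a union of r cosets of R. *)
definition basic_measure :: "('a, 'b) monoid_scheme \<Rightarrow> 'a set \<Rightarrow> real"
  where "basic_measure G A =
    (if A \<in> basic_measurable_sets G
     then THE m. \<exists>R F. R \<lhd> G \<and> R \<in> finite_index_subgroups G \<and>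
            F \<subseteq> rcosets\<^bsub>G\<^esub> R \<and> A = \<Union>F \<and>
            m = real (card F) / real (card (rcosets\<^bsub>G\<^esub> R))
     else undefined)"

(* Meaningful only for non-empty measurable A and B. *)
definition ruzsa_distance :: "('a, 'b) monoid_scheme \<Rightarrow> 'a set \<Rightarrow> 'a set \<Rightarrow> real"
  where "ruzsa_distance G A B =
    ln (basic_measure G (A <#>\<^bsub>G\<^esub> (set_inv\<^bsub>G\<^esub> B)) /
        (basic_measure G A powr (1/2) * basic_measure G B powr (1/2)))"

end

theory Submission
  imports Defs
begin

text \<open>Passing to the quotient by a normal subgroup of finite index contained in all the subgroups
  involved, measures become cardinalities in a finite group, where
  \<open>|H K| |H \<inter> K| = |H| |K|\<close>. Hence
  \<open>d(H, K) = log (|H|^(1/2) |K|^(1/2) / |H \<inter> K|)\<close>, which makes symmetry, positivity and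
  definiteness visible. The triangle inequality becomes \<open>|H \<inter> K| |K \<inter> L| \<le> |K| |H \<inter> L|\<close>, and this
  is the product formula for \<open>H \<inter> K\<close> and \<open>K \<inter> L\<close>, whose product set lies in \<open>K\<close>.\<close>

section \<open>Counting in finite subgroups\<close>

text \<open>All fibres of the multiplication map from \<open>H \<times> K\<close> onto
  \<open>H <#> K\<close> have the same size: the pairs with product \<open>a \<otimes> b\<close> are
  exactly the \<open>(a \<otimes> z, inv z \<otimes> b)\<close> with
  \<open>z \<in> H \<inter> K\<close>.\<close>

lemma (in group) card_set_mult_subgroups:
  assumes H: "subgroup H G" and K: "subgroup K G" and fin: "finite H" "finite K"
  shows "card (H <#> K) * card (H \<inter> K) = card H * card K"
proof -
  let ?m = "\<lambda>p. fst p \<otimes> snd p"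
  have img: "?m ` (H \<times> K) = H <#> K"
    by (force simp: set_mult_def)
  have fibre: "card {p \<in> H \<times> K. ?m p = y} = card (H \<inter> K)" if y: "y \<in> H <#> K" for y
  proof -
    obtain a b where ab: "a \<in> H" "b \<in> K" "y = a \<otimes> b"
      using y unfolding set_mult_def by blast
    have c: "a \<in> carrier G" "b \<in> carrier G"
      using ab H K by (auto dest: subgroup.mem_carrier)
    have "bij_betw (\<lambda>z. (a \<otimes> z, inv z \<otimes> b)) (H \<inter> K) {p \<in> H \<times> K. ?m p = y}"
    proof (rule bij_betw_byWitness[where f' = "\<lambda>p. inv a \<otimes> fst p"])
      show "\<forall>z\<in>H \<inter> K. inv a \<otimes> fst (a \<otimes> z, inv z \<otimes> b) = z"
        using c H by (auto simp: m_assoc[symmetric] dest: subgroup.mem_carrier)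
      show "\<forall>p\<in>{p \<in> H \<times> K. ?m p = y}.
              (a \<otimes> (inv a \<otimes> fst p), inv (inv a \<otimes> fst p) \<otimes> b) = p"
      proof
        fix p assume "p \<in> {p \<in> H \<times> K. ?m p = y}"
        then obtain h k where p: "p = (h, k)" and hk: "h \<in> H" "k \<in> K" "h \<otimes> k = y"
          by auto
        have hc: "h \<in> carrier G" "k \<in> carrier G"
          using hk H K by (auto dest: subgroup.mem_carrier)
        have "inv (inv a \<otimes> h) \<otimes> b = inv h \<otimes> (h \<otimes> k)"
          using c hc hk ab by (simp add: inv_mult_group m_assoc)
        also have "\<dots> = k"
          using hc by (simp add: m_assoc[symmetric])
        finally show "(a \<otimes> (inv a \<otimes> fst p), inv (inv a \<otimes> fst p) \<otimes> b) = p"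
          using c hc p by (simp add: m_assoc[symmetric])
      qed
      show "(\<lambda>z. (a \<otimes> z, inv z \<otimes> b)) ` (H \<inter> K) \<subseteq> {p \<in> H \<times> K. ?m p = y}"
      proof (rule image_subsetI)
        fix z assume "z \<in> H \<inter> K"
        then have z: "z \<in> H" "z \<in> K" by simp_all
        have zc: "z \<in> carrier G"
          using z H by (auto dest: subgroup.mem_carrier)
        have "a \<otimes> z \<otimes> (inv z \<otimes> b) = a \<otimes> (z \<otimes> inv z) \<otimes> b"
          using c zc by (simp only: m_assoc inv_closed m_closed)
        then show "(a \<otimes> z, inv z \<otimes> b) \<in> {p \<in> H \<times> K. ?m p = y}"
          using c zc z ab H K by (auto intro: subgroup.m_closed subgroup.m_inv_closed)
      qed
      show "(\<lambda>p. inv a \<otimes> fst p) ` {p \<in> H \<times> K. ?m p = y} \<subseteq> H \<inter> K"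
      proof (rule image_subsetI)
        fix p assume "p \<in> {p \<in> H \<times> K. ?m p = y}"
        then obtain h k where p: "p = (h, k)" and hk: "h \<in> H" "k \<in> K" "h \<otimes> k = y"
          by auto
        have hc: "h \<in> carrier G" "k \<in> carrier G"
          using hk H K by (auto dest: subgroup.mem_carrier)
        \<comment> \<open>The parameter \<open>z\<close> of a pair \<open>(h, k)\<close> in the
          fibre is \<open>inv a \<otimes> h\<close>. It lies in \<open>H\<close>, and
          \<open>h \<otimes> k = a \<otimes> b\<close> rewrites it as
          \<open>b \<otimes> inv k\<close>, which lies in \<open>K\<close>.\<close>
        have "inv a \<otimes> h = inv a \<otimes> (h \<otimes> k) \<otimes> inv k"
          using c hc by (simp add: m_assoc)
        also have "\<dots> = b \<otimes> inv k"
          using c hc hk ab by (simp add: m_assoc[symmetric])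
        finally have "inv a \<otimes> h = b \<otimes> inv k" .
        then show "inv a \<otimes> fst p \<in> H \<inter> K"
          using p hk ab H K by (metis IntI fst_conv subgroup.m_closed subgroup.m_inv_closed)
      qed
    qed
    then show ?thesis
      by (simp add: bij_betw_same_card)
  qed
  have "card H * card K = (\<Sum>p\<in>H \<times> K. 1)"
    by (simp add: card_cartesian_product)
  also have "\<dots> = (\<Sum>y\<in>?m ` (H \<times> K). \<Sum>p\<in>{p \<in> H \<times> K. ?m p = y}. 1)"
    by (rule sum.image_gen) (use fin in simp)
  also have "\<dots> = (\<Sum>y\<in>H <#> K. card {p \<in> H \<times> K. ?m p = y})"
    unfolding img by simp
  also have "\<dots> = card (H <#> K) * card (H \<inter> K)"
    by (simp add: fibre)
  finally show ?thesis by simp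
qed

lemma (in group) card_inter_subgroups_triangle:
  assumes H: "subgroup H G" and K: "subgroup K G" and L: "subgroup L G"
    and fin: "finite H" "finite K" "finite L"
  shows "card (H \<inter> K) * card (K \<inter> L) \<le> card K * card (H \<inter> L)"
proof -
  have sub: "subgroup (H \<inter> K) G" "subgroup (K \<inter> L) G"
    using H K L by (simp_all add: subgroups_Inter_pair)
  have "card (H \<inter> K) * card (K \<inter> L)
      = card ((H \<inter> K) <#> (K \<inter> L)) * card ((H \<inter> K) \<inter> (K \<inter> L))"
    using card_set_mult_subgroups[OF sub] fin by simp
  also have "\<dots> \<le> card K * card (H \<inter> L)"
  proof (rule mult_le_mono)
    show "card ((H \<inter> K) <#> (K \<inter> L)) \<le> card K"
      using subgroup.m_closed[OF K] by (intro card_mono fin) (auto simp: set_mult_def)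
    show "card ((H \<inter> K) \<inter> (K \<inter> L)) \<le> card (H \<inter> L)"
      by (rule card_mono) (use fin in auto)
  qed
  finally show ?thesis .
qed

section \<open>Normal subgroups of finite index below given subgroups\<close>

text \<open>The group acts on the finite family \<open>\<C>\<close> by right translation, and
  \<open>N\<close> is the kernel of this action. A coset of \<open>N\<close> is determined by the
  self-map of \<open>\<C>\<close> that it induces, and there are only finitely many such
  maps.\<close>

lemma (in group) stabilizer_finite_index_normal:
  assumes fin: "finite \<C>" and sub: "\<And>C. C \<in> \<C> \<Longrightarrow> C \<subseteq> carrier G"
    and inv: "\<And>C x. C \<in> \<C> \<Longrightarrow> x \<in> carrier G \<Longrightarrow> C #> x \<in> \<C>"
  defines "N \<equiv> {g \<in> carrier G. \<forall>C\<in>\<C>. C #> g = C}"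
  shows "N \<lhd> G" "N \<in> finite_index_subgroups G"
proof -
  have sg: "subgroup N G"
  proof (rule subgroupI)
    show "N \<subseteq> carrier G" "N \<noteq> {}"
      using sub coset_mult_one by (auto simp: N_def)
    show "inv a \<in> N" if "a \<in> N" for a
    proof -
      have "C #> inv a = C" if "C \<in> \<C>" for C
        using \<open>a \<in> N\<close> sub[OF that] that coset_mult_inv1[of C \<one> a] coset_mult_assoc[of C a "inv a"]
        by (simp add: N_def)
      then show ?thesis using that by (simp add: N_def)
    qed
    show "a \<otimes> b \<in> N" if "a \<in> N" "b \<in> N" for a b
      using that sub by (auto simp: N_def coset_mult_assoc[symmetric])
  qed
  show "N \<lhd> G"
    unfolding normal_inv_iff
  proof (intro conjI ballI sg)
    fix x h assume x: "x \<in> carrier G" and h: "h \<in> N"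
    have hc: "h \<in> carrier G" using h by (simp add: N_def)
    have "C #> (x \<otimes> h \<otimes> inv x) = C" if C: "C \<in> \<C>" for C
    proof -
      have "C #> (x \<otimes> h \<otimes> inv x) = C #> x #> h #> inv x"
        using x hc sub[OF C] by (simp add: coset_mult_assoc r_coset_subset_G m_assoc)
      \<comment> \<open>Invariance of the family enters here: \<open>C #> x\<close> is again a
        member, so \<open>h\<close> fixes it.\<close>
      also have "C #> x #> h = C #> x"
        using h inv[OF C x] by (simp add: N_def)
      also have "C #> x #> inv x = C"
        using x sub[OF C] by (simp add: coset_mult_assoc)
      finally show ?thesis .
    qed
    then show "x \<otimes> h \<otimes> inv x \<in> N" using x hc by (simp add: N_def)
  qed
  \<comment> \<open>The restriction places \<open>act g\<close> in the extensional function space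
    over \<open>\<C>\<close>, which is finite.\<close>
  define act where "act = (\<lambda>g. restrict (\<lambda>C. C #> g) \<C>)"
  have "act ` carrier G \<subseteq> \<C> \<rightarrow>\<^sub>E \<C>"
    using inv by (auto simp: act_def)
  then have fin_act: "finite (act ` carrier G)"
    using fin by (meson finite_PiE finite_subset)
  have same: "N #> x = N #> y"
    if xy: "x \<in> carrier G" "y \<in> carrier G" "act x = act y" for x y
  proof -
    have "C #> (x \<otimes> inv y) = C" if C: "C \<in> \<C>" for C
    proof -
      have "C #> x = C #> y"
        using fun_cong[OF xy(3), of C] C by (simp add: act_def)
      then show ?thesis
        using coset_mult_inv1 coset_mult_assoc xy sub[OF C] coset_mult_one by (metis inv_closed r_inv)
    qed
    then have "x \<otimes> inv y \<in> N" using xy by (simp add: N_def)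
    then show ?thesis
      using xy sg by (metis coset_join2 coset_mult_inv1 inv_closed m_closed subgroup.subset)
  qed
  \<comment> \<open>By \<open>same\<close>, the coset \<open>N #> x\<close> depends only on
    \<open>act x\<close>, so any chosen preimage of \<open>act x\<close> gives the same
    coset.\<close>
  have "rcosets N \<subseteq> (\<lambda>a. N #> (SOME x. x \<in> carrier G \<and> act x = a)) ` (act ` carrier G)"
  proof
    fix D assume "D \<in> rcosets N"
    then obtain x where x: "x \<in> carrier G" "D = N #> x"
      by (auto simp: RCOSETS_def)
    let ?y = "SOME y. y \<in> carrier G \<and> act y = act x"
    have "?y \<in> carrier G \<and> act ?y = act x"
      by (rule someI[of _ x]) (use x in simp)
    then have "D = N #> ?y" using x same by metis
    then show "D \<in> (\<lambda>a. N #> (SOME x. x \<in> carrier G \<and> act x = a)) ` (act ` carrier G)"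
      using x by auto
  qed
  then have "finite (rcosets N)"
    using fin_act by (meson finite_imageI finite_subset)
  then show "N \<in> finite_index_subgroups G"
    using sg by (simp add: finite_index_subgroups_def)
qed

text \<open>Let the group act on all right cosets of all members of \<open>\<H>\<close> at once. An
  element of the kernel fixes in particular the coset \<open>H\<close> itself, hence lies in
  \<open>H\<close>.\<close>

lemma (in group) common_finite_index_normal_subgroup:
  assumes "finite \<H>" "\<H> \<subseteq> finite_index_subgroups G"
  shows "\<exists>N. N \<lhd> G \<and> N \<in> finite_index_subgroups G \<and> (\<forall>H\<in>\<H>. N \<subseteq> H)"
proof -
  define \<C> where "\<C> = (\<Union>H\<in>\<H>. rcosets H)"
  define N where "N = {g \<in> carrier G. \<forall>C\<in>\<C>. C #> g = C}"
  have sg: "subgroup H G" if "H \<in> \<H>" for H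
    using that assms by (auto simp: finite_index_subgroups_def)
  have 1: "finite \<C>"
    using assms by (auto simp: \<C>_def finite_index_subgroups_def)
  have 2: "C \<subseteq> carrier G" if "C \<in> \<C>" for C
    using that sg by (auto simp: \<C>_def dest: rcosets_part_G)
  have 3: "C #> x \<in> \<C>" if "C \<in> \<C>" "x \<in> carrier G" for C x
  proof -
    obtain H y where "H \<in> \<H>" "y \<in> carrier G" "C = H #> y"
      using \<open>C \<in> \<C>\<close> by (auto simp: \<C>_def RCOSETS_def)
    moreover from this have "C #> x = H #> (y \<otimes> x)"
      using that sg by (simp add: coset_mult_assoc subgroup.subset)
    ultimately show ?thesis
      using that by (auto simp: \<C>_def RCOSETS_def)
  qed
  have "N \<subseteq> H" if H: "H \<in> \<H>" for H
  proof
    fix g assume g: "g \<in> N"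
    have "H \<in> \<C>"
      using H sg[OF H] subgroup.subgroup_in_rcosets[OF _ is_group] by (auto simp: \<C>_def)
    then have "H #> g = H" using g by (simp add: N_def)
    then show "g \<in> H"
      using g sg[OF H] rcos_self by (force simp: N_def)
  qed
  then show ?thesis
    using stabilizer_finite_index_normal[OF 1 2 3] unfolding N_def by blast
qed

section \<open>The basic measure as a proportion of cosets\<close>

text \<open>Every coset of \<open>R\<close> splits into the same number of cosets of
  \<open>N\<close>, and different cosets of \<open>R\<close> share none of them. Cross-multiplied,
  this says that the proportion of cosets in a set is unchanged on passing from \<open>R\<close> to
  \<open>N\<close>.\<close>

lemma (in group) card_rcosets_refine:
  assumes R: "R \<in> finite_index_subgroups G" and N: "N \<in> finite_index_subgroups G"
    and NR: "N \<subseteq> R" and F: "F \<subseteq> rcosets R"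
  shows "card ((\<lambda>x. N #> x) ` \<Union>F) * card (rcosets R) = card F * card (rcosets N)"
proof -
  let ?p = "\<lambda>x. N #> x"
  have sR: "subgroup R G" and fR: "finite (rcosets R)"
    and sN: "subgroup N G" and fN: "finite (rcosets N)"
    using R N by (auto simp: finite_index_subgroups_def)
  have subN: "N \<subseteq> carrier G" and subR: "R \<subseteq> carrier G"
    using sN sR by (auto dest: subgroup.subset)
  have card1: "card (?p ` C) = card (?p ` R)" if C: "C \<in> rcosets R" for C
  proof -
    obtain x where x: "x \<in> carrier G" "C = R #> x"
      using C by (auto simp: RCOSETS_def)
    \<comment> \<open>Right translation by \<open>x\<close> carries the cosets of \<open>N\<close>
      inside \<open>R\<close> to those inside \<open>R #> x\<close>.\<close>
    have "?p ` C = (\<lambda>D. D #> x) ` ?p ` R"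
      using x subN subR by (force simp: r_coset_def[of _ R] image_image coset_mult_assoc subsetD)
    moreover have "inj_on (\<lambda>D. D #> x) (?p ` R)"
    proof (rule inj_onI)
      fix D E assume DE: "D \<in> ?p ` R" "E \<in> ?p ` R" "D #> x = E #> x"
      then have "D \<subseteq> carrier G" "E \<subseteq> carrier G"
        using r_coset_subset_G[OF subN] subR by blast+
      then have "D = D #> x #> inv x" "E = E #> x #> inv x"
        using x by (simp_all add: coset_mult_assoc)
      then show "D = E" using DE by simp
    qed
    ultimately show ?thesis by (simp add: card_image)
  qed
  have disj: "?p ` C \<inter> ?p ` D = {}"
    if CD: "C \<in> rcosets R" "D \<in> rcosets R" "C \<noteq> D" for C D
  proof (rule ccontr)
    assume "?p ` C \<inter> ?p ` D \<noteq> {}"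
    then obtain c d where cd: "c \<in> C" "d \<in> D" "N #> c = N #> d" by auto
    have car: "c \<in> carrier G" "d \<in> carrier G"
      using cd CD rcosets_part_G[OF sR] by blast+
    then have "c \<in> N #> d" using cd rcos_self sN by blast
    then have "c \<in> R #> d" using NR by (auto simp: r_coset_def)
    then have "R #> d = R #> c"
      using car sR by (metis repr_independence)
    moreover have "C = R #> c" "D = R #> d"
      using cd CD sR by (auto simp: RCOSETS_def dest: repr_independence)
    ultimately show False using CD by simp
  qed
  have main: "card (?p ` \<Union>F') = card F' * card (?p ` R)" if F': "F' \<subseteq> rcosets R" for F'
  proof -
    have fin: "finite (?p ` C)" if "C \<in> F'" for C
    proof (rule finite_subset[OF _ fN])
      show "?p ` C \<subseteq> rcosets N"
        using that F' rcosets_part_G[OF sR] rcosetsI[OF subN] by blast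
    qed
    have "card (?p ` \<Union>F') = card (\<Union>C\<in>F'. ?p ` C)"
      by (simp add: image_Union)
    also have "\<dots> = (\<Sum>C\<in>F'. card (?p ` C))"
    proof (rule card_UN_disjoint)
      show "finite F'" using F' fR by (rule finite_subset)
      show "\<forall>C\<in>F'. finite (?p ` C)" using fin by blast
      show "\<forall>C\<in>F'. \<forall>D\<in>F'. C \<noteq> D \<longrightarrow> ?p ` C \<inter> ?p ` D = {}"
        using F' disj by (metis subsetD)
    qed
    also have "\<dots> = card F' * card (?p ` R)"
      using F' card1 by (simp add: subset_iff)
    finally show ?thesis .
  qed
  have "card (rcosets N) = card (rcosets R) * card (?p ` R)"
  proof -
    have "?p ` \<Union>(rcosets R) = rcosets N"
      using rcosets_part_G[OF sR] by (auto simp: RCOSETS_def)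
    then show ?thesis using main[of "rcosets R"] by simp
  qed
  then show ?thesis using main[OF F] by simp
qed

text \<open>This is the well-definedness of the measure: two representations of a set, over
  \<open>R\<close> and over \<open>R'\<close>, are both refined to a finite index subgroup
  \<open>N\<close> inside \<open>R \<inter> R'\<close>, where they count the same cosets.\<close>

lemma (in group) basic_measure_Union_rcosets:
  assumes R: "R \<lhd> G" "R \<in> finite_index_subgroups G" and F: "F \<subseteq> rcosets R"
  shows "basic_measure G (\<Union>F) = real (card F) / real (card (rcosets R))"
proof -
  have pos: "card (rcosets S) > 0" if "S \<in> finite_index_subgroups G" for S
    using that subgroup.subgroup_in_rcosets[OF _ is_group]
    by (auto simp: finite_index_subgroups_def card_gt_0_iff)
  have "\<Union>F \<in> basic_measurable_sets G"
  proof -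
    have "finite F"
      using F R(2) by (auto simp: finite_index_subgroups_def intro: finite_subset)
    moreover have "\<exists>H\<in>finite_index_subgroups G. \<exists>x\<in>carrier G. C = x <# H \<or> C = H #> x"
      if "C \<in> F" for C
    proof -
      obtain x where "x \<in> carrier G" "C = R #> x"
        using \<open>C \<in> F\<close> F unfolding RCOSETS_def by blast
      then show ?thesis using R(2) by blast
    qed
    ultimately show ?thesis
      unfolding basic_measurable_sets_def by blast
  qed
  moreover have "(THE m. \<exists>R' F'. R' \<lhd> G \<and> R' \<in> finite_index_subgroups G \<and>
      F' \<subseteq> rcosets R' \<and> \<Union>F = \<Union>F' \<and> m = real (card F') / real (card (rcosets R')))
    = real (card F) / real (card (rcosets R))"
  proof (rule the_equality)
    show "\<exists>R' F'. R' \<lhd> G \<and> R' \<in> finite_index_subgroups G \<and> F' \<subseteq> rcosets R' \<and>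
        \<Union>F = \<Union>F' \<and> real (card F) / real (card (rcosets R)) = real (card F') / real (card (rcosets R'))"
      using R F by blast
  next
    fix m assume "\<exists>R' F'. R' \<lhd> G \<and> R' \<in> finite_index_subgroups G \<and>
      F' \<subseteq> rcosets R' \<and> \<Union>F = \<Union>F' \<and> m = real (card F') / real (card (rcosets R'))"
    then obtain R' F' where R': "R' \<in> finite_index_subgroups G" "F' \<subseteq> rcosets R'"
      "\<Union>F = \<Union>F'" and m: "m = real (card F') / real (card (rcosets R'))" by blast
    obtain N where N: "N \<in> finite_index_subgroups G" "N \<subseteq> R" "N \<subseteq> R'"
      using common_finite_index_normal_subgroup[of "{R, R'}"] R(2) R'(1) by auto
    have "real (card F) / real (card (rcosets R))
        = real (card ((\<lambda>x. N #> x) ` \<Union>F)) / real (card (rcosets N))"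
      using card_rcosets_refine[OF R(2) N(1,2) F] pos[OF R(2)] pos[OF N(1)]
      by (simp add: field_simps flip: of_nat_mult)
    also have "\<dots> = m"
      using card_rcosets_refine[OF R'(1) N(1,3) R'(2)] pos[OF R'(1)] pos[OF N(1)] 
      unfolding m R'(3) by (simp add: field_simps flip: of_nat_mult)
    finally show "m = real (card F) / real (card (rcosets R))" ..
  qed
  ultimately show ?thesis by (simp add: basic_measure_def)
qed

text \<open>A set closed under left multiplication by \<open>N\<close> is the union of the cosets
  that it meets, so its measure is the relative size of its image in the quotient.\<close>

lemma (in group) basic_measure_saturated:
  assumes N: "N \<lhd> G" "N \<in> finite_index_subgroups G"
    and A: "A \<subseteq> carrier G" "\<And>a. a \<in> A \<Longrightarrow> N #> a \<subseteq> A"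
  shows "basic_measure G A = real (card ((\<lambda>x. N #> x) ` A)) / real (card (rcosets N))"
proof -
  have sN: "subgroup N G" using N by (simp add: finite_index_subgroups_def)
  have "A = \<Union>((\<lambda>x. N #> x) ` A)"
    using A rcos_self[OF _ sN] by blast
  moreover have "(\<lambda>x. N #> x) ` A \<subseteq> rcosets N"
    using A by (auto simp: RCOSETS_def)
  ultimately show ?thesis
    using basic_measure_Union_rcosets[OF N] by metis
qed

lemma (in group) subgroup_rcoset_subset:
  assumes "subgroup H G" "N \<subseteq> H" "a \<in> H"
  shows "N #> a \<subseteq> H"
  using assms by (auto simp: r_coset_def intro: subgroup.m_closed)

section \<open>Passage to the quotient\<close>

text \<open>Images need not commute with intersections, but here \<open>h a = h b\<close> puts
  \<open>b \<otimes> inv a\<close> in the kernel, hence in \<open>A\<close>, and so \<open>b\<close>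
  itself lies in \<open>A\<close>.\<close>

lemma (in group_hom) image_inter_kernel:
  assumes A: "subgroup A G" "kernel G H h \<subseteq> A" and B: "B \<subseteq> carrier G"
  shows "h ` (A \<inter> B) = h ` A \<inter> h ` B"
proof
  show "h ` A \<inter> h ` B \<subseteq> h ` (A \<inter> B)"
  proof
    fix y assume "y \<in> h ` A \<inter> h ` B"
    then obtain a b where ab: "a \<in> A" "b \<in> B" "y = h a" "y = h b" by auto
    have c: "a \<in> carrier G" "b \<in> carrier G"
      using ab A B by (auto dest: subgroup.mem_carrier)
    have "b \<otimes> inv a \<in> kernel G H h"
      using c ab by (simp add: kernel_def)
    then have "b \<otimes> inv a \<otimes> a \<in> A"
      using A ab by (auto intro: subgroup.m_closed)
    then have "b \<in> A" using c by (simp add: G.m_assoc)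
    then show "y \<in> h ` (A \<inter> B)" using ab(2,4) by blast
  qed
qed auto

lemma (in group) set_inv_subgroup:
  assumes "subgroup H G"
  shows "set_inv H = H"
  using assms subgroup.m_inv_closed[OF assms] subgroup.mem_carrier[OF assms]
  by (force simp: SET_INV_def intro!: bexI[of _ "inv _"])

lemma (in normal) kernel_r_coset: "kernel G (G Mod H) (\<lambda>x. H #> x) = H"
  using coset_join1[OF _ _ subgroup_axioms] coset_join2[OF _ subgroup_axioms]
  by (auto simp: kernel_def)

lemma (in normal) group_hom_r_coset: "group_hom G (G Mod H) (\<lambda>x. H #> x)"
  by (simp add: group_hom_def group_hom_axioms_def is_group factorgroup_is_group r_coset_hom_Mod)

lemma (in normal) finite_r_coset_image:
  assumes "finite (rcosets H)" "A \<subseteq> carrier G"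
  shows "finite ((\<lambda>x. H #> x) ` A)"
  using assms by (auto simp: RCOSETS_def intro: finite_subset[rotated])

lemma (in normal) r_coset_image_inter:
  assumes "subgroup A G" "H \<subseteq> A" "B \<subseteq> carrier G"
  shows "(\<lambda>x. H #> x) ` (A \<inter> B) = (\<lambda>x. H #> x) ` A \<inter> (\<lambda>x. H #> x) ` B"
  using group_hom.image_inter_kernel[OF group_hom_r_coset] assms by (simp add: kernel_r_coset)

section \<open>Ruzsa distance between finite index subgroups\<close>

text \<open>\<open>c A\<close> is the size of the image of \<open>A\<close> in the quotient by
  \<open>N\<close>. Leaving \<open>N\<close> free allows several distances to be computed in one and
  the same quotient.\<close>

lemma (in group) ruzsa_distance_finite_index:
  assumes H: "H \<in> finite_index_subgroups G" and K: "K \<in> finite_index_subgroups G"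
    and N: "N \<lhd> G" "N \<in> finite_index_subgroups G" "N \<subseteq> H" "N \<subseteq> K"
  defines "c \<equiv> \<lambda>A. real (card ((\<lambda>x. N #> x) ` A))"
  shows "ruzsa_distance G H K = (ln (c H) + ln (c K)) / 2 - ln (c (H \<inter> K))"
proof -
  let ?p = "\<lambda>x. N #> x"
  interpret N: normal N G by (rule N)
  interpret p: group_hom G "G Mod N" ?p by (rule N.group_hom_r_coset)
  have sH: "subgroup H G" and sK: "subgroup K G" and fN: "finite (rcosets N)"
    using H K N by (auto simp: finite_index_subgroups_def)
  have HG: "H \<subseteq> carrier G" and KG: "K \<subseteq> carrier G"
    using sH sK by (auto dest: subgroup.subset)
  have HKG: "H <#> K \<subseteq> carrier G"
    using HG KG by (rule set_mult_closed)
  define q where "q = real (card (rcosets N))"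
  have q: "q > 0"
    using fN N.subgroup_in_rcosets[OF is_group] by (auto simp: q_def card_gt_0_iff)
  have pos: "c A > 0" if "A \<subseteq> carrier G" "A \<noteq> {}" for A
    using that N.finite_r_coset_image[OF fN] by (simp add: c_def card_gt_0_iff)
  have one: "\<one> \<in> H" "\<one> \<in> K"
    using sH sK by (auto intro: subgroup.one_closed)
  have posH: "c H > 0" and posK: "c K > 0" and posI: "c (H \<inter> K) > 0"
    using one HG KG by (auto intro!: pos)
  have "\<one> \<otimes> \<one> \<in> H <#> K"
    using one unfolding set_mult_def by blast
  then have posP: "c (H <#> K) > 0"
    using HKG by (auto intro!: pos)
  \<comment> \<open>The set \<open>H <#> K\<close> need not be a subgroup, so its saturation is
    checked directly: a factor from \<open>N\<close> on the left is absorbed by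
    \<open>H\<close>.\<close>
  have sat: "N #> a \<subseteq> H <#> K" if a: "a \<in> H <#> K" for a
  proof -
    obtain h k where hk: "h \<in> H" "k \<in> K" "a = h \<otimes> k"
      using a by (auto simp: set_mult_def)
    have "n \<otimes> a = (n \<otimes> h) \<otimes> k \<and> n \<otimes> h \<in> H" if "n \<in> N" for n
    proof -
      have "n \<in> H" using that N by blast
      then show ?thesis
        using hk HG KG by (auto simp: m_assoc subset_iff intro: subgroup.m_closed[OF sH])
    qed
    then show ?thesis
      using hk(2) unfolding r_coset_def set_mult_def by blast
  qed
  have mH: "basic_measure G H = c H / q" and mK: "basic_measure G K = c K / q"
    and mP: "basic_measure G (H <#> K) = c (H <#> K) / q"
    unfolding c_def q_def
    using basic_measure_saturated[OF N(1,2)] HG KG HKG sat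
      subgroup_rcoset_subset[OF sH N(3)] subgroup_rcoset_subset[OF sK N(4)] by auto
  \<comment> \<open>The product formula is applied in the finite quotient: the image of
    \<open>H <#> K\<close> is the product of the images, and the image of
    \<open>H \<inter> K\<close> is their intersection because
    \<open>N \<subseteq> H\<close>.\<close>
  have "card (?p ` (H <#> K)) * card (?p ` (H \<inter> K)) = card (?p ` H) * card (?p ` K)"
    unfolding set_mult_hom[OF N.r_coset_hom_Mod HG KG] N.r_coset_image_inter[OF sH N(3) KG]
    using HG KG by (intro p.H.card_set_mult_subgroups p.subgroup_img_is_subgroup sH sK
        N.finite_r_coset_image fN)
  then have "c (H <#> K) * c (H \<inter> K) = c H * c K"
    unfolding c_def by (simp flip: of_nat_mult)
  then have "ln (c (H <#> K)) + ln (c (H \<inter> K)) = ln (c H) + ln (c K)"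
    using posH posK posI posP by (metis ln_mult_pos)
  \<comment> \<open>Since \<open>K\<close> is its own inverse set, the numerator is the measure of
    \<open>H <#> K\<close>. The index \<open>q\<close> cancels, as the two square roots together
    contribute one factor \<open>1 / q\<close>.\<close>
  moreover have "ruzsa_distance G H K = ln (c (H <#> K)) - (ln (c H) + ln (c K)) / 2"
    using posH posK posP q
    by (simp add: ruzsa_distance_def set_inv_subgroup[OF sK] mH mK mP ln_div ln_mult field_simps)
  ultimately show ?thesis by (simp add: field_simps)
qed

text \<open>The count forces \<open>H\<close> and \<open>H \<inter> K\<close> to have equal images.
  Each \<open>h \<in> H\<close> then lies in a coset \<open>N #> x\<close> with
  \<open>x \<in> K\<close>, and this coset is contained in \<open>K\<close>.\<close>

lemma (in group) subset_if_card_r_coset_image_le: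
  assumes N: "N \<lhd> G" "finite (rcosets N)" "N \<subseteq> H" "N \<subseteq> K"
    and H: "subgroup H G" and K: "subgroup K G"
    and le: "card ((\<lambda>x. N #> x) ` H) \<le> card ((\<lambda>x. N #> x) ` (H \<inter> K))"
  shows "H \<subseteq> K"
proof
  interpret N: normal N G by (rule N)
  fix h assume h: "h \<in> H"
  have HG: "H \<subseteq> carrier G" using H by (rule subgroup.subset)
  have "(\<lambda>x. N #> x) ` (H \<inter> K) = (\<lambda>x. N #> x) ` H"
    by (rule card_seteq) (use le N.finite_r_coset_image[OF N(2) HG] in auto)
  then obtain x where x: "x \<in> K" "N #> h = N #> x" using h by blast
  have "h \<in> N #> h" using h HG rcos_self N.subgroup_axioms by blast
  then show "h \<in> K" using x subgroup_rcoset_subset[OF K N(4)] by blast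
qed

section \<open>The metric axioms\<close>

theorem corollary3p7:
  fixes G :: "('a, 'b) monoid_scheme"
  assumes "group G"
  shows "Metric_space (finite_index_subgroups G)
           (\<lambda>H K. if H \<in> finite_index_subgroups G \<and> K \<in> finite_index_subgroups G
                   then ruzsa_distance G H K else 0)"
proof -
  interpret group G by fact
  let ?S = "finite_index_subgroups G"
  define c where "c = (\<lambda>N A. card ((\<lambda>x. r_coset G N x) ` A))"
  have sub: "subgroup H G" if "H \<in> ?S" for H
    using that by (simp add: finite_index_subgroups_def)
  have fin: "finite ((\<lambda>x. r_coset G N x) ` A)"
    if "N \<lhd> G" "N \<in> ?S" "A \<subseteq> carrier G" for N A
    using that normal.finite_r_coset_image[of N G A] by (simp add: finite_index_subgroups_def)
  have pos: "c N A > 0" if "N \<lhd> G" "N \<in> ?S" "A \<subseteq> carrier G" "\<one>\<^bsub>G\<^esub> \<in> A" for N A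
    using that fin[of N A] by (auto simp: c_def card_gt_0_iff)
  have dist: "ruzsa_distance G H K
      = (ln (real (c N H)) + ln (real (c N K))) / 2 - ln (real (c N (H \<inter> K)))"
    if "H \<in> ?S" "K \<in> ?S" "N \<lhd> G" "N \<in> ?S" "N \<subseteq> H" "N \<subseteq> K" for H K N
    using ruzsa_distance_finite_index[OF that] by (simp add: c_def)
  have two: "0 \<le> ruzsa_distance G H K \<and> ruzsa_distance G H K = ruzsa_distance G K H
      \<and> (ruzsa_distance G H K = 0 \<longleftrightarrow> H = K)"
    if HK: "H \<in> ?S" "K \<in> ?S" for H K
  proof -
    obtain N where N: "N \<lhd> G" "N \<in> ?S" "N \<subseteq> H" "N \<subseteq> K"
      using common_finite_index_normal_subgroup[of "{H, K}"] HK by auto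
    note s = sub[OF HK(1)] sub[OF HK(2)]
    have car: "H \<subseteq> carrier G" "K \<subseteq> carrier G" "H \<inter> K \<subseteq> carrier G"
      using s by (auto dest: subgroup.subset)
    have one: "\<one>\<^bsub>G\<^esub> \<in> H" "\<one>\<^bsub>G\<^esub> \<in> K"
      using s by (auto intro: subgroup.one_closed)
    have p: "c N H > 0" "c N K > 0" "c N (H \<inter> K) > 0"
      using pos[OF N(1,2)] car one by auto
    have le: "c N (H \<inter> K) \<le> c N H" "c N (H \<inter> K) \<le> c N K"
      unfolding c_def by (rule card_mono; use fin[OF N(1,2)] car in auto)+
    \<comment> \<open>The distance is the mean of the two differences of logarithms compared here.
      Both are nonnegative, so the distance is, and it vanishes only if both do.\<close>
    then have ln_le: "ln (real (c N (H \<inter> K))) \<le> ln (real (c N H))"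
      "ln (real (c N (H \<inter> K))) \<le> ln (real (c N K))"
      using p by simp_all
    have "H = K" if "ruzsa_distance G H K = 0"
    proof -
      have "ln (real (c N (H \<inter> K))) = ln (real (c N H))"
        and "ln (real (c N (H \<inter> K))) = ln (real (c N K))"
        using that ln_le dist[OF HK N] by (simp_all add: field_simps)
      then have "c N (H \<inter> K) = c N H" "c N (K \<inter> H) = c N K"
        using p by (simp_all add: Int_commute)
      then show ?thesis
        using subset_if_card_r_coset_image_le[OF N(1) _ N(3,4) s]
          subset_if_card_r_coset_image_le[OF N(1) _ N(4,3) s(2,1)] N(2)
        by (simp add: c_def finite_index_subgroups_def)
    qed
    moreover have "ruzsa_distance G H K = 0" if "H = K"
      using dist[OF HK N] that by simp
    moreover have "0 \<le> ruzsa_distance G H K"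
      using ln_le dist[OF HK N] by argo
    moreover have "ruzsa_distance G H K = ruzsa_distance G K H"
      using dist[OF HK N] dist[OF HK(2,1) N(1,2,4,3)] by (simp add: Int_commute)
    ultimately show ?thesis by blast
  qed
  have triangle: "ruzsa_distance G H L \<le> ruzsa_distance G H K + ruzsa_distance G K L"
    if HKL: "H \<in> ?S" "K \<in> ?S" "L \<in> ?S" for H K L
  proof -
    \<comment> \<open>One \<open>N\<close> below all three subgroups expresses the three distances
      by counts in a single quotient.\<close>
    obtain N where N: "N \<lhd> G" "N \<in> ?S" and NH: "N \<subseteq> H" "N \<subseteq> K" "N \<subseteq> L"
      using common_finite_index_normal_subgroup[of "{H, K, L}"] HKL by auto
    interpret N: normal N G by (rule N)
    interpret p: group_hom G "G Mod N" "\<lambda>x. r_coset G N x" by (rule N.group_hom_r_coset)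
    note s = sub[OF HKL(1)] sub[OF HKL(2)] sub[OF HKL(3)]
    have car: "H \<subseteq> carrier G" "K \<subseteq> carrier G" "L \<subseteq> carrier G"
      using s by (auto dest: subgroup.subset)
    have one: "\<one>\<^bsub>G\<^esub> \<in> H" "\<one>\<^bsub>G\<^esub> \<in> K" "\<one>\<^bsub>G\<^esub> \<in> L"
      using s by (auto intro: subgroup.one_closed)
    have p: "c N K > 0" "c N (H \<inter> K) > 0" "c N (K \<inter> L) > 0" "c N (H \<inter> L) > 0"
      using pos[OF N] car one by (auto simp: le_infI1)
    have "c N (H \<inter> K) * c N (K \<inter> L) \<le> c N K * c N (H \<inter> L)"
      unfolding c_def N.r_coset_image_inter[OF s(1) NH(1) car(2)]
        N.r_coset_image_inter[OF s(2) NH(2) car(3)] N.r_coset_image_inter[OF s(1) NH(1) car(3)]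
      by (intro p.H.card_inter_subgroups_triangle p.subgroup_img_is_subgroup s fin N car)
    then have "real (c N (H \<inter> K)) * real (c N (K \<inter> L)) \<le> real (c N K) * real (c N (H \<inter> L))"
      by (simp flip: of_nat_mult)
    then have "ln (real (c N (H \<inter> K)) * real (c N (K \<inter> L)))
        \<le> ln (real (c N K) * real (c N (H \<inter> L)))"
      using p by simp
    \<comment> \<open>This is the triangle inequality rearranged: the terms of \<open>H\<close> and
      \<open>L\<close> cancel, and the two halves of \<open>ln (real (c N K))\<close> add
      up.\<close>
    then have "ln (real (c N (H \<inter> K))) + ln (real (c N (K \<inter> L)))
        \<le> ln (real (c N K)) + ln (real (c N (H \<inter> L)))"
      using p by (simp add: ln_mult)
    then show ?thesis
      using dist[OF HKL(1,2) N NH(1,2)] dist[OF HKL(2,3) N NH(2,3)] dist[OF HKL(1,3) N NH(1,3)]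
      by argo
  qed
  show ?thesis
    \<comment> \<open>\<open>Metric_space\<close> demands nonnegativity and symmetry for all
      arguments, also outside the carrier; there the default value 0 supplies them.\<close>
    using two triangle by unfold_locales auto
qed

end
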